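(* The chromatic number $\sigma_n$ of the $n$-dimensional stellohedron (with respect to proper colourings of its facets) satisfies $$n+1\leq\sigma_n\leq 2n-1-\left\lfloor\frac{n-1}{2}\right\rfloor.$$
   Context: For $n\geq 1$ let $[n]=\{1,\ldots,n\}$ and $[n]_0=\{0,1,\ldots,n\}$. A building set is a collection $\mathcal{B}$ of nonempty subsets of $[n]_0$ containing all singletons $\{x\}$, $x\in[n]_0$, such that $S_1,S_2\in\mathcal{B}$ and $S_1\cap S_2\neq\emptyset$ imply $S_1\cup S_2\in\mathcal{B}$. For a family of sets $N$, an $N$-antichain is a subset $\{X_1,\ldots,X_m\}\subseteq N$ with $m\geq 2$ whose members are mutually incomparable with respect to $\subseteq$. Assuming $[n]_0\in\mathcal{B}$, a set $N\subseteq\mathcal{B}$ is nested when the union of every $N$-antichain is not an element of $\mathcal{B}$. The nested-set complex of $\mathcal{B}$ is the simplicial complex of all nested sets $N$ with $[n]_0\notin N$. It is realised by a simple $n$-dimensional polytope (the nestohedron of $\mathcal{B}$): its face lattice with the bottom (the empty face) removed is isomorphic to the complex ordered by $\supseteq$. Hence its facets are identified with the elements $X\in\mathcal{B}$, $X\neq[n]_0$, and two facets have a common vertex iff some nested set contains both. The $n$-dimensional stellohedron is the nestohedron of the building set of all nonempty connected subsets of vertices of the star on $[n]_0$ whose $n$ edges connect the vertex $0$ with all the other vertices. Its facets are thus identified with the proper subsets of $[n]_0$ containing $0$ together with the singletons $\{1\},\ldots,\{n\}$. Two facets of a polytope are separated when they have no vertex in common. For $\mathcal{F}$ the set of facets of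 a polytope, a function $f\colon\mathcal{F}\to[m]$ is a proper colouring when every two (distinct) facets of the same colour are separated. The chromatic number of the polytope is the minimal $m$ such that a proper colouring of its facets with $m$ colours exists.
   Formalization: The formal statement assumes n ≥ 2: for n = 1 the stellohedron is a segment with two disjoint facets, so its chromatic number is 1 and the claimed bounds 2 ≤ σ_1 ≤ 1 are contradictory. *)

theory Defs
  imports "HOL-Analysis.Analysis"
begin

section \<open>Building sets and nested sets\<close>

text \<open>The ground set \<open>[n]\<^sub>0\<close> is \<open>{0..n}\<close>, and \<open>[n]\<close> is \<open>{1..n}\<close>, as sets of natural numbers.\<close>

definition building_set :: "nat \<Rightarrow> nat set set \<Rightarrow> bool" where
  "building_set n B \<longleftrightarrow>
     (\<forall>S\<in>B. S \<noteq> {} \<and> S \<subseteq> {0..n}) \<and>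
     (\<forall>x\<in>{0..n}. {x} \<in> B) \<and>
     (\<forall>S1\<in>B. \<forall>S2\<in>B. S1 \<inter> S2 \<noteq> {} \<longrightarrow> S1 \<union> S2 \<in> B)"

definition set_antichain :: "'v set set \<Rightarrow> 'v set set \<Rightarrow> bool" where
  "set_antichain N A \<longleftrightarrow>
     A \<subseteq> N \<and> finite A \<and> card A \<ge> 2 \<and> pairwise (\<lambda>X Y. \<not> X \<subseteq> Y) A"

definition nested :: "'v set set \<Rightarrow> 'v set set \<Rightarrow> bool" where
  "nested B N \<longleftrightarrow> N \<subseteq> B \<and> (\<forall>A. set_antichain N A \<longrightarrow> \<Union>A \<notin> B)"

definition nested_set_complex :: "nat \<Rightarrow> nat set set \<Rightarrow> nat set set set" where
  "nested_set_complex n B = {N. nested B N \<and> {0..n} \<notin> N}"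

text \<open>
  A nestohedron is determined only up to combinatorial type: \<open>nestohedron n B P\<close> says that \<open>P\<close> is
  an \<open>n\<close>-dimensional polytope whose nonempty faces (including \<open>P\<close> itself, the image of the empty
  nested set), ordered by inclusion, correspond to the nested sets ordered by reverse inclusion.
  Simplicity of \<open>P\<close> follows from this, since the faces containing a given vertex correspond to the
  subsets of a nested set.
\<close>

definition nestohedron :: "nat \<Rightarrow> nat set set \<Rightarrow> 'a::euclidean_space set \<Rightarrow> bool" where
  "nestohedron n B P \<longleftrightarrow>
     polytope P \<and> aff_dim P = int n \<and>
     (\<exists>\<phi>. bij_betw \<phi> (nested_set_complex n B) {F. F face_of P \<and> F \<noteq> {}} \<and>
          (\<forall>N\<in>nested_set_complex n B. \<forall>M\<in>nested_set_complex n B.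
              \<phi> N \<subseteq> \<phi> M \<longleftrightarrow> M \<subseteq> N))"


section \<open>The stellohedron\<close>

definition connected_in_graph :: "('v \<times> 'v) set \<Rightarrow> 'v set \<Rightarrow> bool" where
  "connected_in_graph E S \<longleftrightarrow> (\<forall>x\<in>S. \<forall>y\<in>S. (x, y) \<in> (E \<inter> S \<times> S)\<^sup>*)"

text \<open>The star with centre \<open>0\<close>, as a symmetric relation.\<close>

definition star_edges :: "nat \<Rightarrow> (nat \<times> nat) set" where
  "star_edges n = {0} \<times> {1..n} \<union> {1..n} \<times> {0}"

definition star_building_set :: "nat \<Rightarrow> nat set set" where
  "star_building_set n = {S. S \<noteq> {} \<and> S \<subseteq> {0..n} \<and> connected_in_graph (star_edges n) S}"

definition stellohedron :: "nat \<Rightarrow> 'a::euclidean_space set \<Rightarrow> bool" where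
  "stellohedron n P \<longleftrightarrow> nestohedron n (star_building_set n) P"

lemma star_building_set_eq:
  "star_building_set n = {S. S \<subseteq> {0..n} \<and> 0 \<in> S} \<union> {{i} |i. i \<in> {1..n}}"
proof (intro equalityI subsetI)
  fix S assume "S \<in> star_building_set n"
  then have S: "S \<noteq> {}" "S \<subseteq> {0..n}"
    and con: "\<And>x y. x \<in> S \<Longrightarrow> y \<in> S \<Longrightarrow> (x, y) \<in> (star_edges n \<inter> S \<times> S)\<^sup>*"
    by (auto simp: star_building_set_def connected_in_graph_def)
  show "S \<in> {S. S \<subseteq> {0..n} \<and> 0 \<in> S} \<union> {{i} |i. i \<in> {1..n}}"
  proof (cases "0 \<in> S")
    case True
    then show ?thesis using S by auto
  next
    case False
    then have "star_edges n \<inter> S \<times> S = {}" by (auto simp: star_edges_def)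
    then have eq: "x = y" if "x \<in> S" "y \<in> S" for x y
      using con[OF that] by simp
    obtain i where i: "i \<in> S" using S by blast
    then have "S = {i}" using eq by blast
    moreover have "i \<in> {1..n}" using i S False by (cases i) auto
    ultimately show ?thesis by blast
  qed
next
  fix S assume "S \<in> {S. S \<subseteq> {0..n} \<and> 0 \<in> S} \<union> {{i} |i. i \<in> {1..n}}"
  then consider "S \<subseteq> {0..n}" "0 \<in> S" | i where "i \<in> {1..n}" "S = {i}" by blast
  then show "S \<in> star_building_set n"
  proof cases
    case 1
    have to0: "(x, 0) \<in> (star_edges n \<inter> S \<times> S)\<^sup>*" and from0: "(0, x) \<in> (star_edges n \<inter> S \<times> S)\<^sup>*"
      if "x \<in> S" for x
    proof -
      have "x = 0 \<or> x \<in> {1..n}" using that 1 by (cases x) auto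
      then have "x = 0 \<or> ((x, 0) \<in> star_edges n \<inter> S \<times> S \<and> (0, x) \<in> star_edges n \<inter> S \<times> S)"
        using that 1 by (auto simp: star_edges_def)
      then show "(x, 0) \<in> (star_edges n \<inter> S \<times> S)\<^sup>*" "(0, x) \<in> (star_edges n \<inter> S \<times> S)\<^sup>*"
        by (auto intro: r_into_rtrancl)
    qed
    then have "connected_in_graph (star_edges n) S"
      unfolding connected_in_graph_def by (blast intro: rtrancl_trans)
    then show ?thesis using 1 by (auto simp: star_building_set_def)
  next
    case 2
    then show ?thesis by (auto simp: star_building_set_def connected_in_graph_def)
  qed
qed

lemma building_set_star: "building_set n (star_building_set n)"
  unfolding building_set_def star_building_set_eq
  by (auto simp: Suc_le_eq)


section \<open>Colourings of the facets of a polytope\<close>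

definition separated :: "'a::euclidean_space set \<Rightarrow> 'a set \<Rightarrow> 'a set \<Rightarrow> bool" where
  "separated P F G \<longleftrightarrow> \<not> (\<exists>v. v extreme_point_of P \<and> v \<in> F \<and> v \<in> G)"

definition proper_facet_colouring :: "'a::euclidean_space set \<Rightarrow> nat \<Rightarrow> ('a set \<Rightarrow> nat) \<Rightarrow> bool" where
  "proper_facet_colouring P m f \<longleftrightarrow>
     (\<forall>F. F facet_of P \<longrightarrow> f F \<in> {1..m}) \<and>
     (\<forall>F G. F facet_of P \<and> G facet_of P \<and> F \<noteq> G \<and> f F = f G \<longrightarrow> separated P F G)"

text \<open>
  A polytope has finitely many facets, so the set of admissible \<open>m\<close> is nonempty and \<open>LEAST\<close> is a
  genuine minimum.
\<close>

definition facet_chromatic_number :: "'a::euclidean_space set \<Rightarrow> nat" where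
  "facet_chromatic_number P = (LEAST m. \<exists>f. proper_facet_colouring P m f)"

end

theory Submission
  imports Defs
begin

text \<open>
  Facets of a nestohedron are the elements \<open>X \<noteq> {0..n}\<close> of its building set, and two of them
  share a vertex exactly when the pair is nested, so the chromatic number of the polytope is that
  of a graph on the building set (\<open>facet_colouring_iff_nested_colouring\<close>).  For the star this graph
  is explicit: the singletons \<open>{i}\<close> with \<open>i \<in> {1..n}\<close> form a clique, sets containing \<open>0\<close> are
  adjacent when comparable, and \<open>{i}\<close> is adjacent to \<open>X \<ni> 0\<close> when \<open>i \<in> X\<close>.

  Lower bound.  The singletons use \<open>n\<close> different colours.  If there were no other colour, a set
  \<open>X \<ni> 0\<close> would have the colour of some \<open>{i}\<close> with \<open>i \<notin> X\<close>.  This forces \<open>{0..n} - {i}\<close> to have the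
  colour of \<open>{i}\<close>, and then \<open>{0..n} - {1, 2}\<close>, having the colour of \<open>{1}\<close> or of \<open>{2}\<close>, shares it
  with a larger set.

  Upper bound.  Give \<open>{i}\<close> the colour \<open>i\<close>.  A set \<open>X \<ni> 0\<close> with at least as many elements of
  \<open>{1..n}\<close> outside as \<open>X\<close> has elements reuses one of these colours: it gets the \<open>card X\<close>-th element
  \<open>x\<close> of \<open>{1..n} - X\<close>.  Since \<open>x \<notin> X\<close>, this does not clash with \<open>{x}\<close>; and enlarging \<open>X\<close> raises
  \<open>card X\<close> but cannot raise the number of elements of \<open>{1..x}\<close> outside \<open>X\<close>, so comparable sets get
  different elements.  The remaining sets have cardinality between \<open>(n + 1) div 2 + 1\<close> and \<open>n\<close>, and
  each cardinality is an antichain that gets one new colour, \<open>n div 2\<close> in all.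
\<close>

section \<open>Facets of a nestohedron\<close>

lemma nested_empty: "nested B {}"
  by (auto simp: nested_def set_antichain_def)

lemma nested_subset: "nested B N \<Longrightarrow> M \<subseteq> N \<Longrightarrow> nested B M"
  unfolding nested_def set_antichain_def by blast

lemma nested_pair_iff:
  assumes "X \<in> B" "Y \<in> B"
  shows "nested B {X, Y} \<longleftrightarrow> X \<subseteq> Y \<or> Y \<subseteq> X \<or> X \<union> Y \<notin> B"
proof -
  have anti: "A = {X, Y} \<and> \<not> X \<subseteq> Y \<and> \<not> Y \<subseteq> X" if "set_antichain {X, Y} A" for A
  proof -
    from that have A: "A \<subseteq> {X, Y}" "card A \<ge> 2" and pw: "pairwise (\<lambda>U V. \<not> U \<subseteq> V) A"
      by (auto simp: set_antichain_def)
    have "card {X, Y} \<le> 2" by (simp add: card_insert_if)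
    then have "A = {X, Y}" using A card_seteq[of "{X, Y}" A] by simp
    moreover from this have "X \<noteq> Y" using A by auto
    ultimately show ?thesis using pw by (auto simp: pairwise_def)
  qed
  show ?thesis
  proof
    assume n: "nested B {X, Y}"
    show "X \<subseteq> Y \<or> Y \<subseteq> X \<or> X \<union> Y \<notin> B"
    proof (rule ccontr)
      assume c: "\<not> ?thesis"
      then have "X \<noteq> Y" by auto
      then have "set_antichain {X, Y} {X, Y}"
        using c by (auto simp: set_antichain_def pairwise_def)
      then have "\<Union>{X, Y} \<notin> B" using n unfolding nested_def by blast
      then show False using c by simp
    qed
  next
    assume "X \<subseteq> Y \<or> Y \<subseteq> X \<or> X \<union> Y \<notin> B"
    then show "nested B {X, Y}"
      unfolding nested_def using assms anti by fastforce
  qed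
qed

lemma nested_singleton: "X \<in> B \<Longrightarrow> nested B {X}"
  using nested_pair_iff[of X B X] by simp

lemma facet_of_maximal:
  fixes P :: "'a::euclidean_space set"
  assumes "convex P" "F facet_of P" "G face_of P" "F \<subseteq> G" "G \<noteq> P"
  shows "F = G"
proof (rule ccontr)
  assume "F \<noteq> G"
  have "F face_of G"
    using assms face_of_subset[of F P G] face_of_imp_subset[of G P] by (simp add: facet_of_def)
  then have "aff_dim F < aff_dim G"
    using \<open>F \<noteq> G\<close> assms face_of_imp_convex face_of_aff_dim_lt by blast
  moreover have "aff_dim G < aff_dim P"
    using assms face_of_aff_dim_lt by blast
  ultimately show False using assms by (simp add: facet_of_def)
qed

text \<open>
  Facets are the maximal proper faces, so the order-reversing bijection sends them to the minimal
  nonempty nested sets, which are the singletons.  Every nonempty face has a vertex, and the vertices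
  of a face \<open>\<phi> N\<close> are the \<open>\<phi> M\<close> with \<open>M\<close> a maximal nested set containing \<open>N\<close>; this turns
  common vertices into nestedness of the pair.
\<close>

lemma nestohedron_facet_labelling:
  fixes P :: "'a::euclidean_space set"
  assumes "nestohedron n B P"
  obtains \<psi> where "bij_betw \<psi> (B - {{0..n}}) {F. F facet_of P}"
    and "\<forall>X \<in> B - {{0..n}}. \<forall>Y \<in> B - {{0..n}}.
           separated P (\<psi> X) (\<psi> Y) \<longleftrightarrow> \<not> nested B {X, Y}"
proof -
  define K where "K = nested_set_complex n B"
  from assms obtain \<phi> where P: "polytope P" "aff_dim P = int n"
    and bij: "bij_betw \<phi> K {F. F face_of P \<and> F \<noteq> {}}"
    and ord_all: "\<forall>N\<in>K. \<forall>M\<in>K. \<phi> N \<subseteq> \<phi> M \<longleftrightarrow> M \<subseteq> N"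
    unfolding nestohedron_def K_def by (elim conjE exE)
  have ord: "\<phi> N \<subseteq> \<phi> M \<longleftrightarrow> M \<subseteq> N" if "N \<in> K" "M \<in> K" for N M
    using ord_all that by simp
  have cvx: "convex P" and "P \<noteq> {}"
    using P polytope_imp_convex by auto
  have face: "\<phi> N face_of P" "\<phi> N \<noteq> {}" if "N \<in> K" for N
    using bij_betw_apply[OF bij that] by auto
  have surj: "\<exists>N\<in>K. F = \<phi> N" if "F face_of P" "F \<noteq> {}" for F
    using bij that unfolding bij_betw_def by blast
  have inj: "N = M" if "N \<in> K" "M \<in> K" "\<phi> N = \<phi> M" for N M
    using ord that by blast
  have K0: "{} \<in> K"
    by (simp add: K_def nested_set_complex_def nested_empty)
  have K1: "{X} \<in> K" if "X \<in> B - {{0..n}}" for X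
    using that by (auto simp: K_def nested_set_complex_def nested_singleton)
  have K2: "{X, Y} \<in> K \<longleftrightarrow> nested B {X, Y}" if "X \<in> B - {{0..n}}" "Y \<in> B - {{0..n}}" for X Y
    using that by (auto simp: K_def nested_set_complex_def)
  have Kin: "X \<in> B - {{0..n}}" if "N \<in> K" "X \<in> N" for X N
    using that by (auto simp: K_def nested_set_complex_def nested_def)
  have top: "\<phi> {} = P"
  proof -
    obtain M where "M \<in> K" "P = \<phi> M"
      using surj[OF face_of_refl[OF cvx] \<open>P \<noteq> {}\<close>] by blast
    then show ?thesis
      using ord[OF _ K0] face[OF K0] face_of_imp_subset by blast
  qed
  have ne_top: "\<phi> N \<noteq> P" if "N \<in> K" "N \<noteq> {}" for N
    using inj[OF _ K0] that top by metis
  have facet: "\<phi> {X} facet_of P" if X: "X \<in> B - {{0..n}}" for X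
  proof -
    obtain G where G: "G facet_of P" "\<phi> {X} \<subseteq> G"
      using face_of_polyhedron_subset_facet[of P "\<phi> {X}"] face[OF K1[OF X]] ne_top[OF K1[OF X]]
        P polytope_imp_polyhedron by auto
    then obtain N where N: "N \<in> K" "G = \<phi> N"
      using surj[of G] by (auto simp: facet_of_def)
    then have "N \<subseteq> {X}" using ord[OF K1[OF X]] G by auto
    moreover have "N \<noteq> {}" using N G top facet_of_irrefl by auto
    ultimately have "N = {X}" by blast
    then show ?thesis using N G by simp
  qed
  have facet_ex: "\<exists>X \<in> B - {{0..n}}. F = \<phi> {X}" if F: "F facet_of P" for F
  proof -
    obtain N where N: "N \<in> K" "F = \<phi> N"
      using surj[of F] F by (auto simp: facet_of_def)
    have "N \<noteq> {}" using N F top facet_of_irrefl by auto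
    then obtain X where X: "X \<in> N" by blast
    have X': "X \<in> B - {{0..n}}" using Kin N X by blast
    have "F \<subseteq> \<phi> {X}" using N ord[OF N(1) K1[OF X']] X by simp
    then have "F = \<phi> {X}"
      using facet_of_maximal[OF cvx F] face[OF K1[OF X']] ne_top[OF K1[OF X']] by blast
    then show ?thesis using X' by blast
  qed
  have "bij_betw (\<lambda>X. \<phi> {X}) (B - {{0..n}}) {F. F facet_of P}"
    unfolding bij_betw_def
  proof
    show "inj_on (\<lambda>X. \<phi> {X}) (B - {{0..n}})"
      using inj[OF K1 K1] by (auto intro!: inj_onI)
    show "(\<lambda>X. \<phi> {X}) ` (B - {{0..n}}) = {F. F facet_of P}"
      using facet facet_ex by blast
  qed
  moreover have "separated P (\<phi> {X}) (\<phi> {Y}) \<longleftrightarrow> \<not> nested B {X, Y}"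
    if X: "X \<in> B - {{0..n}}" and Y: "Y \<in> B - {{0..n}}" for X Y
  proof
    assume s: "separated P (\<phi> {X}) (\<phi> {Y})"
    show "\<not> nested B {X, Y}"
    proof
      assume "nested B {X, Y}"
      then have XY: "{X, Y} \<in> K" using K2 X Y by simp
      have "compact (\<phi> {X, Y})" "convex (\<phi> {X, Y})"
        using face[OF XY] P face_of_polytope_polytope polytope_imp_compact polytope_imp_convex
        by blast+
      then obtain v where v: "v extreme_point_of \<phi> {X, Y}"
        using extreme_point_exists_convex face[OF XY] by blast
      then have "v extreme_point_of P" "v \<in> \<phi> {X, Y}"
        using extreme_point_of_face[OF face(1)[OF XY]] by auto
      moreover have "\<phi> {X, Y} \<subseteq> \<phi> {X}" "\<phi> {X, Y} \<subseteq> \<phi> {Y}"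
        using ord[OF XY] K1 X Y by auto
      ultimately show False using s by (auto simp: separated_def)
    qed
  next
    assume nn: "\<not> nested B {X, Y}"
    show "separated P (\<phi> {X}) (\<phi> {Y})"
      unfolding separated_def
    proof
      assume "\<exists>v. v extreme_point_of P \<and> v \<in> \<phi> {X} \<and> v \<in> \<phi> {Y}"
      then obtain v where v: "{v} face_of P" "{v} \<subseteq> \<phi> {X}" "{v} \<subseteq> \<phi> {Y}"
        by (auto simp: face_of_singleton)
      then obtain N where N: "N \<in> K" "{v} = \<phi> N" using surj[of "{v}"] by blast
      then have "{X} \<subseteq> N" "{Y} \<subseteq> N"
        using v ord[OF N(1)] K1 X Y by metis+
      then have "{X, Y} \<subseteq> N" by simp
      moreover have "nested B N" using N by (simp add: K_def nested_set_complex_def)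
      ultimately show False using nn nested_subset by blast
    qed
  qed
  ultimately show thesis by (intro that ballI)
qed

definition nested_colouring :: "nat \<Rightarrow> nat set set \<Rightarrow> nat \<Rightarrow> (nat set \<Rightarrow> nat) \<Rightarrow> bool" where
  "nested_colouring n B m c \<longleftrightarrow>
     (\<forall>X \<in> B - {{0..n}}. c X \<in> {1..m}) \<and>
     (\<forall>X \<in> B - {{0..n}}. \<forall>Y \<in> B - {{0..n}}. X \<noteq> Y \<and> nested B {X, Y} \<longrightarrow> c X \<noteq> c Y)"

lemma facet_colouring_iff_nested_colouring:
  fixes P :: "'a::euclidean_space set"
  assumes "nestohedron n B P"
  shows "(\<exists>f. proper_facet_colouring P m f) \<longleftrightarrow> (\<exists>c. nested_colouring n B m c)"
proof -
  define V where "V = B - {{0..n}}"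
  obtain \<psi> where bij: "bij_betw \<psi> V {F. F facet_of P}"
    and sep: "\<forall>X\<in>V. \<forall>Y\<in>V. separated P (\<psi> X) (\<psi> Y) \<longleftrightarrow> \<not> nested B {X, Y}"
    unfolding V_def by (rule nestohedron_facet_labelling[OF assms])
  have inj: "\<psi> X = \<psi> Y \<longleftrightarrow> X = Y" if "X \<in> V" "Y \<in> V" for X Y
    using bij that by (auto simp: bij_betw_def inj_on_def)
  have all: "(\<forall>F. F facet_of P \<longrightarrow> Q F) \<longleftrightarrow> (\<forall>X\<in>V. Q (\<psi> X))" for Q
  proof -
    have "(\<forall>F. F facet_of P \<longrightarrow> Q F) \<longleftrightarrow> (\<forall>F \<in> \<psi> ` V. Q F)"
      using bij by (simp add: bij_betw_def)
    then show ?thesis by simp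
  qed
  have col: "proper_facet_colouring P m f \<longleftrightarrow> nested_colouring n B m (f \<circ> \<psi>)" for f
  proof -
    have "proper_facet_colouring P m f \<longleftrightarrow>
        (\<forall>F. F facet_of P \<longrightarrow> f F \<in> {1..m}) \<and>
        (\<forall>F. F facet_of P \<longrightarrow> (\<forall>G. G facet_of P \<longrightarrow> F \<noteq> G \<and> f F = f G \<longrightarrow> separated P F G))"
      unfolding proper_facet_colouring_def by blast
    also have "\<dots> \<longleftrightarrow> (\<forall>X\<in>V. f (\<psi> X) \<in> {1..m}) \<and>
        (\<forall>X\<in>V. \<forall>Y\<in>V. \<psi> X \<noteq> \<psi> Y \<and> f (\<psi> X) = f (\<psi> Y) \<longrightarrow> separated P (\<psi> X) (\<psi> Y))"
      by (simp only: all)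
    also have "\<dots> \<longleftrightarrow> nested_colouring n B m (f \<circ> \<psi>)"
      unfolding nested_colouring_def V_def[symmetric] comp_def
      by (intro conj_cong ball_cong refl) (use sep inj in blast)+
    finally show ?thesis .
  qed
  show ?thesis
  proof
    assume "\<exists>f. proper_facet_colouring P m f"
    then show "\<exists>c. nested_colouring n B m c" using col by blast
  next
    assume "\<exists>c. nested_colouring n B m c"
    then obtain c where c: "nested_colouring n B m c" by blast
    have "inv_into V \<psi> (\<psi> X) = X" if "X \<in> V" for X
      using bij that by (auto simp: bij_betw_def)
    then have "nested_colouring n B m ((c \<circ> inv_into V \<psi>) \<circ> \<psi>)"
      using c unfolding nested_colouring_def V_def[symmetric] by simp
    then show "\<exists>f. proper_facet_colouring P m f" using col by blast
  qed
qed

section \<open>Adjacent facets of the stellohedron\<close>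

lemma star_singleton: "i \<in> {1..n} \<Longrightarrow> {i} \<in> star_building_set n - {{0..n}}"
  by (auto simp: star_building_set_eq)

lemma star_central: "0 \<in> X \<Longrightarrow> X \<subset> {0..n} \<Longrightarrow> X \<in> star_building_set n - {{0..n}}"
  by (auto simp: star_building_set_eq)

lemma star_facet_cases:
  assumes "X \<in> star_building_set n - {{0..n}}"
  obtains (leaf) i where "i \<in> {1..n}" "X = {i}" | (central) "0 \<in> X" "X \<subset> {0..n}"
  using assms by (auto simp: star_building_set_eq)

lemma star_nested_singletons:
  assumes "i \<in> {1..n}" "j \<in> {1..n}"
  shows "nested (star_building_set n) {{i}, {j}}"
proof -
  have "i = j \<or> {i} \<union> {j} \<notin> star_building_set n"
    using assms by (auto simp: star_building_set_eq doubleton_eq_iff)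
  then show ?thesis
    using nested_pair_iff[of "{i}" _ "{j}"] star_singleton assms by auto
qed

lemma star_nested_singleton_central:
  assumes "i \<in> {1..n}" "0 \<in> X" "X \<subset> {0..n}"
  shows "nested (star_building_set n) {{i}, X} \<longleftrightarrow> i \<in> X"
proof -
  have "{i} \<union> X \<in> star_building_set n" "X \<noteq> {i}"
    using assms by (auto simp: star_building_set_eq)
  moreover have "\<not> X \<subseteq> {i}" using assms by auto
  ultimately show ?thesis
    using nested_pair_iff[of "{i}" _ X] star_singleton star_central assms by auto
qed

lemma star_nested_centrals:
  assumes "0 \<in> X" "X \<subset> {0..n}" "0 \<in> Y" "Y \<subset> {0..n}"
  shows "nested (star_building_set n) {X, Y} \<longleftrightarrow> X \<subseteq> Y \<or> Y \<subseteq> X"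
proof -
  have "X \<union> Y \<in> star_building_set n"
    using assms by (auto simp: star_building_set_eq)
  then show ?thesis
    using nested_pair_iff[of X _ Y] star_central assms by auto
qed

section \<open>The lower bound\<close>

lemma star_colouring_lower_bound:
  assumes "n \<ge> 2" and c: "nested_colouring n (star_building_set n) m c"
  shows "n + 1 \<le> m"
proof (rule ccontr)
  assume "\<not> n + 1 \<le> m"
  let ?V = "star_building_set n - {{0..n}}"
  have rng: "c X \<in> {1..m}" if "X \<in> ?V" for X
    using c that by (auto simp: nested_colouring_def)
  have proper: "c X \<noteq> c Y"
    if "X \<in> ?V" "Y \<in> ?V" "X \<noteq> Y" "nested (star_building_set n) {X, Y}" for X Y
    using c that by (auto simp: nested_colouring_def)
  have "inj_on (\<lambda>i. c {i}) {1..n}"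
  proof (rule inj_onI)
    fix i j assume "i \<in> {1..n}" "j \<in> {1..n}" "c {i} = c {j}"
    then show "i = j"
      using proper[of "{i}" "{j}"] star_singleton star_nested_singletons by blast
  qed
  then have "card ((\<lambda>i. c {i}) ` {1..n}) = n" by (simp add: card_image)
  moreover have "(\<lambda>i. c {i}) ` {1..n} \<subseteq> {1..m}" using rng star_singleton by blast
  ultimately have leaf_colours: "(\<lambda>i. c {i}) ` {1..n} = {1..m}"
    using \<open>\<not> n + 1 \<le> m\<close> by (intro card_seteq) auto
  have reuse: "\<exists>i\<in>{1..n}. c X = c {i} \<and> i \<notin> X" if X: "0 \<in> X" "X \<subset> {0..n}" for X
  proof -
    from rng[OF star_central[OF X]] leaf_colours
    obtain i where i: "i \<in> {1..n}" "c X = c {i}" by blast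
    have "{i} \<noteq> X" using i X by auto
    then have "i \<notin> X"
      using proper[OF star_singleton[OF i(1)] star_central[OF X]]
        star_nested_singleton_central[OF i(1) X] i by auto
    then show ?thesis using i by blast
  qed
  \<comment> \<open>The only element outside this set is \<open>i\<close>, so \<open>{i}\<close> is the only possible partner.\<close>
  have coatom: "c ({0..n} - {i}) = c {i}" if "i \<in> {1..n}" for i
    using reuse[of "{0..n} - {i}"] that by fastforce
  define Y where "Y = {0..n} - {1, 2}"
  have Y: "0 \<in> Y" "Y \<subset> {0..n}"
  proof -
    show "0 \<in> Y" by (simp add: Y_def)
    have "1 \<in> {0..n} - Y" using assms(1) by (simp add: Y_def)
    then show "Y \<subset> {0..n}" unfolding Y_def by blast
  qed
  from reuse[OF Y] obtain i where i: "i \<in> {1..n}" "c Y = c {i}" "i \<notin> Y"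
    by metis
  define X where "X = {0..n} - {i}"
  have X: "0 \<in> X" "X \<subset> {0..n}"
  proof -
    show "0 \<in> X" using i(1) by (simp add: X_def)
    have "i \<in> {0..n}" using i(1) by simp
    then show "X \<subset> {0..n}" unfolding X_def by blast
  qed
  have "i = 1 \<or> i = 2" using i(1,3) by (auto simp: Y_def)
  then have "Y \<subseteq> X" by (auto simp: X_def Y_def)
  moreover have "Y \<noteq> X"
  proof
    assume "Y = X"
    moreover have "1 \<in> X \<or> 2 \<in> X" using \<open>i = 1 \<or> i = 2\<close> assms(1) by (auto simp: X_def)
    ultimately show False unfolding Y_def by blast
  qed
  ultimately have "c Y \<noteq> c X"
    using proper[OF star_central[OF Y] star_central[OF X]] star_nested_centrals[OF Y X] by simp
  then show False using coatom[OF i(1)] i(2) by (simp add: X_def)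
qed

section \<open>The upper bound\<close>

text \<open>
  This is the \<open>k\<close>-th element of \<open>{1..n} - X\<close>.  Its position is expressed by a count, as this is the
  form that can be compared for different sets \<open>X\<close>.
\<close>

lemma exists_kth_missing_element:
  fixes X :: "nat set"
  assumes "0 < k" "k \<le> card ({1..n} - X)"
  shows "\<exists>x\<in>{1..n}. x \<notin> X \<and> card ({1..x} - X) = k"
  using assms(2)
proof (induction n)
  case 0
  then show ?case using assms(1) by simp
next
  case (Suc n)
  show ?case
  proof (cases "k \<le> card ({1..n} - X)")
    case True
    then show ?thesis using Suc.IH atLeastAtMost_iff le_SucI by metis
  next
    case False
    have step: "{1..Suc n} - X = (if Suc n \<in> X then {1..n} - X else insert (Suc n) ({1..n} - X))"
      by (auto simp: le_Suc_eq)
    have "Suc n \<notin> X"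
    proof
      assume "Suc n \<in> X"
      then have "{1..Suc n} - X = {1..n} - X" using step by presburger
      then show False using False Suc.prems by simp
    qed
    then have "{1..Suc n} - X = insert (Suc n) ({1..n} - X)" using step by presburger
    then have "card ({1..Suc n} - X) = Suc (card ({1..n} - X))"
      by (simp del: insert_Diff_if)
    then have "card ({1..Suc n} - X) = k" using False Suc.prems by linarith
    then show ?thesis using \<open>Suc n \<notin> X\<close> by (intro bexI[of _ "Suc n"]) auto
  qed
qed

text \<open>
  The position \<open>card X\<close> is what makes comparable sets get different elements: it grows with \<open>X\<close>,
  whereas the count \<open>card ({1..x} - X)\<close> for a fixed \<open>x\<close> can only shrink.  Such an element exists
  for sets containing \<open>0\<close> up to about half of \<open>{0..n}\<close>.
\<close>

definition missing_element :: "nat \<Rightarrow> nat set \<Rightarrow> nat" where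
  "missing_element n X = (SOME x. x \<in> {1..n} \<and> x \<notin> X \<and> card ({1..x} - X) = card X)"

lemma missing_element:
  assumes "0 \<in> X" "X \<subset> {0..n}" "2 * card X \<le> n + 1"
  shows "missing_element n X \<in> {1..n}" "missing_element n X \<notin> X"
    "card ({1..missing_element n X} - X) = card X"
proof -
  have fin: "finite X" using assms finite_subset by blast
  have "card ({0..n} - X) = n + 1 - card X"
    using fin assms by (subst card_Diff_subset) auto
  moreover have "{0..n} - X = {1..n} - X"
    using assms by (auto simp: Suc_le_eq intro!: gr0I)
  ultimately have "card X \<le> card ({1..n} - X)" using assms by simp
  moreover have "0 < card X" using fin assms by (auto simp: card_gt_0_iff)
  ultimately have "\<exists>x. x \<in> {1..n} \<and> x \<notin> X \<and> card ({1..x} - X) = card X"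
    using exists_kth_missing_element by blast
  from someI_ex[OF this]
  show "missing_element n X \<in> {1..n}" "missing_element n X \<notin> X"
    "card ({1..missing_element n X} - X) = card X"
    unfolding missing_element_def by auto
qed

lemma missing_element_strict_subset:
  assumes "0 \<in> X" "X \<subset> Y" "Y \<subset> {0..n}" "2 * card Y \<le> n + 1"
  shows "missing_element n X \<noteq> missing_element n Y"
proof
  assume eq: "missing_element n X = missing_element n Y"
  have "finite Y" using assms finite_subset by blast
  then have less: "card X < card Y" using assms psubset_card_mono by blast
  have "card Y = card ({1..missing_element n Y} - Y)"
    using missing_element[of Y n] assms by auto
  also have "\<dots> \<le> card ({1..missing_element n Y} - X)"
    using assms by (intro card_mono) auto
  also have "\<dots> = card X"
    using missing_element[of X n] assms less eq by auto
  finally show False using less by simp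
qed

definition stellohedron_colour :: "nat \<Rightarrow> nat set \<Rightarrow> nat" where
  "stellohedron_colour n X =
     (if 0 \<notin> X then the_elem X
      else if 2 * card X \<le> n + 1 then missing_element n X
      else n + card X - (n + 1) div 2)"

lemma star_colouring_upper_bound:
  "nested_colouring n (star_building_set n) (n + n div 2) (stellohedron_colour n)"
proof -
  let ?V = "star_building_set n - {{0..n}}" and ?c = "stellohedron_colour n"
  have leaf_colour: "?c {i} = i" if "i \<in> {1..n}" for i
    using that by (simp add: stellohedron_colour_def)
  have small: "?c X = missing_element n X" if "0 \<in> X" "2 * card X \<le> n + 1" for X
    using that by (simp add: stellohedron_colour_def)
  have large: "?c X = n + card X - (n + 1) div 2" if "0 \<in> X" "\<not> 2 * card X \<le> n + 1" for X
    using that by (simp add: stellohedron_colour_def)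
  have large_range: "n < ?c X \<and> ?c X \<le> n + n div 2"
    if "0 \<in> X" "X \<subset> {0..n}" "\<not> 2 * card X \<le> n + 1" for X
  proof -
    \<comment> \<open>\<open>card X \<le> n\<close> gives the colour \<open>2 * n - (n + 1) div 2 = n + n div 2\<close> at most.\<close>
    have "card X < card {0..n}" using that by (intro psubset_card_mono) auto
    then show ?thesis using large[OF that(1,3)] that(3) by simp linarith
  qed
  have range: "?c X \<in> {1..n + n div 2}" if "X \<in> ?V" for X
    using that
  proof (cases rule: star_facet_cases)
    case (leaf i)
    then show ?thesis using leaf_colour by auto
  next
    case central
    then show ?thesis
      using small[of X] missing_element(1)[of X n] large_range[of X]
      by (cases "2 * card X \<le> n + 1") auto
  qed
  have leaf_central: "?c {i} \<noteq> ?c X"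
    if "i \<in> {1..n}" "0 \<in> X" "X \<subset> {0..n}" "nested (star_building_set n) {{i}, X}" for i X
  proof -
    have "i \<in> X" using that star_nested_singleton_central by blast
    then show ?thesis
      using leaf_colour[OF that(1)] small[of X] missing_element(2)[of X n] large_range[of X] that
      by (cases "2 * card X \<le> n + 1") auto
  qed
  have nested_centrals: "?c X \<noteq> ?c Y" if "0 \<in> X" "X \<subset> Y" "Y \<subset> {0..n}" for X Y
  proof -
    have "finite Y" using that finite_subset by blast
    then have less: "card X < card Y" using that psubset_card_mono by blast
    have X: "X \<subset> {0..n}" and Y: "0 \<in> Y" using that by auto
    consider "2 * card Y \<le> n + 1" | "2 * card X \<le> n + 1" "\<not> 2 * card Y \<le> n + 1"
      | "\<not> 2 * card X \<le> n + 1" by blast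
    then show ?thesis
    proof cases
      case 1
      then show ?thesis
        using small[OF that(1)] small[OF Y] less missing_element_strict_subset[OF that] by simp
    next
      case 2
      then show ?thesis
        using small[OF that(1)] missing_element(1)[OF that(1) X]
          large_range[OF Y that(3)] by auto
    next
      case 3
      then show ?thesis
        using large[OF that(1)] large[OF Y] less by auto
    qed
  qed
  have "?c X \<noteq> ?c Y"
    if "X \<in> ?V" "Y \<in> ?V" and ne: "X \<noteq> Y" and nest: "nested (star_building_set n) {X, Y}" for X Y
    using \<open>X \<in> ?V\<close>
  proof (cases rule: star_facet_cases)
    case X: (leaf i)
    from \<open>Y \<in> ?V\<close> show ?thesis
    proof (cases rule: star_facet_cases)
      case (leaf j)
      then show ?thesis using X ne leaf_colour by simp
    next
      case central
      then show ?thesis using X nest leaf_central by simp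
    qed
  next
    case X: central
    from \<open>Y \<in> ?V\<close> show ?thesis
    proof (cases rule: star_facet_cases)
      case (leaf j)
      then show ?thesis using X nest leaf_central[of j X] by (auto simp: insert_commute)
    next
      case Y: central
      then have "X \<subset> Y \<or> Y \<subset> X" using star_nested_centrals[OF X Y] nest ne by blast
      then show ?thesis
        using nested_centrals X Y by metis
    qed
  qed
  with range show ?thesis unfolding nested_colouring_def by blast
qed

theorem corollary6p3:
  fixes n :: nat and P :: "'a::euclidean_space set"
  assumes "n \<ge> 2" and "stellohedron n P"
  shows "n + 1 \<le> facet_chromatic_number P \<and>
      int (facet_chromatic_number P) \<le> 2 * int n - 1 - \<lfloor>(real n - 1) / 2\<rfloor>"
proof -
  let ?Q = "\<lambda>m. \<exists>c. nested_colouring n (star_building_set n) m c"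
  have chrom: "facet_chromatic_number P = (LEAST m. ?Q m)"
    using facet_colouring_iff_nested_colouring assms(2)
    unfolding facet_chromatic_number_def stellohedron_def by metis
  have Q: "?Q (n + n div 2)" using star_colouring_upper_bound by blast
  from LeastI[of ?Q, OF Q] have "n + 1 \<le> facet_chromatic_number P"
    unfolding chrom using star_colouring_lower_bound[OF assms(1)] by blast
  moreover have "facet_chromatic_number P \<le> n + n div 2"
    unfolding chrom using Q by (rule Least_le)
  moreover have "\<lfloor>(real n - 1) / 2\<rfloor> = int n - 1 - int (n div 2)"
  proof -
    have "\<lfloor>(real n - 1) / 2\<rfloor> = \<lfloor>real_of_int (int n - 1) / real_of_int 2\<rfloor>" by simp
    also have "\<dots> = (int n - 1) div 2" by (rule floor_divide_of_int_eq)
    also have "\<dots> = int n - 1 - int (n div 2)" by linarith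
    finally show ?thesis .
  qed
  ultimately show ?thesis by linarith
qed

end
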